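(* Let $n\ge1$ and let $A_0,A_1,\dots,A_n$ be distinct nonzero complex numbers. Then, as formal series in $x,x^{-1}$, $$\begin{aligned} &\Big(\frac{1}{1-A_0x}\Big)^2\prod_{i=1}^n\frac1{1-A_ix}-(-1)^n\Big(\frac{A_0^{-1}x^{-1}}{1-A_0^{-1}x^{-1}}\Big)^2\prod_{i=1}^n\frac{A_i^{-1}x^{-1}}{1-A_i^{-1}x^{-1}}\\ &=\sum_{i=1}^n\Big[\Big(\frac{A_i}{A_i-A_0}\Big)^2\prod_{1\le j\le n,\,j\ne i}\frac{A_i}{A_i-A_j}\Big]\delta(A_ix)\\ &\quad+\Big(\prod_{i=1}^n\frac{A_0}{A_0-A_i}\Big)\Big[(D\delta)(A_0x)+\Big(1+\sum_{l=1}^n\frac{A_l}{A_l-A_0}\Big)\delta(A_0x)\Big]. \end{aligned}$$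
   Context: $\delta(x)=\sum_{n\in\mathbb Z}x^n$ and $(D\delta)(x)=\sum_{n\in\mathbb Z}nx^n$. Each $\frac1{1-Ax}$ is expanded as $\sum_{n\ge0}A^nx^n$ (non-negative powers of $x$) and each $\frac{A^{-1}x^{-1}}{1-A^{-1}x^{-1}}$ as $\sum_{n\ge1}A^{-n}x^{-n}$ (negative powers of $x$). *)

theory Defs
  imports Complex_Main "HOL-Computational_Algebra.Formal_Power_Series"
begin

text \<open>A formal series in \<open>x\<close> and \<open>x\<^sup>-\<^sup>1\<close>, unbounded in both directions, is given by its
  coefficients: \<open>f k\<close> is the coefficient of \<open>x\<^sup>k\<close>. There is no product of two such series; all
  products are taken in the ring of power series in \<open>x\<close>, or in that of power series in \<open>x\<^sup>-\<^sup>1\<close>.\<close>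

type_synonym two_sided_series = "int \<Rightarrow> complex"

text \<open>The formal power series \<open>f\<close> evaluated at \<open>x\<close>, respectively at \<open>x\<^sup>-\<^sup>1\<close>.\<close>

definition at_x :: "complex fps \<Rightarrow> two_sided_series" where
  "at_x f = (\<lambda>k. if 0 \<le> k then fps_nth f (nat k) else 0)"

definition at_x_inverse :: "complex fps \<Rightarrow> two_sided_series" where
  "at_x_inverse f = (\<lambda>k. if k \<le> 0 then fps_nth f (nat (- k)) else 0)"

text \<open>The expansion of \<open>1 / (1 - a x)\<close> in powers of \<open>x\<close>.\<close>

definition expand_nonneg :: "complex \<Rightarrow> complex fps" where
  "expand_nonneg a = Abs_fps (\<lambda>m. a ^ m)"

text \<open>The expansion of \<open>a\<^sup>-\<^sup>1 x\<^sup>-\<^sup>1 / (1 - a\<^sup>-\<^sup>1 x\<^sup>-\<^sup>1)\<close> in powers of \<open>x\<^sup>-\<^sup>1\<close>; the variable of the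
  power series here stands for \<open>x\<^sup>-\<^sup>1\<close>.\<close>

definition expand_neg :: "complex \<Rightarrow> complex fps" where
  "expand_neg a = Abs_fps (\<lambda>m. if m = 0 then 0 else inverse a ^ m)"

lemma expand_nonneg_eq: "expand_nonneg a = 1 / (1 - fps_const a * fps_X)"
proof -
  have "(1 - fps_const a * fps_X) * expand_nonneg a = 1"
  proof (rule fps_ext)
    fix m
    show "fps_nth ((1 - fps_const a * fps_X) * expand_nonneg a) m = fps_nth 1 m"
      by (cases m) (simp_all add: expand_nonneg_def left_diff_distrib mult.assoc)
  qed
  then have "inverse (1 - fps_const a * fps_X) = expand_nonneg a"
    by (rule fps_inverse_unique)
  then show ?thesis
    by (simp add: fps_divide_unit)
qed

lemma expand_neg_eq:
  "expand_neg a = fps_const (inverse a) * fps_X / (1 - fps_const (inverse a) * fps_X)"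
proof -
  have "expand_neg a = fps_const (inverse a) * fps_X * expand_nonneg (inverse a)"
  proof (rule fps_ext)
    fix m
    show "fps_nth (expand_neg a) m
        = fps_nth (fps_const (inverse a) * fps_X * expand_nonneg (inverse a)) m"
      by (cases m) (simp_all add: expand_neg_def expand_nonneg_def mult.assoc)
  qed
  then show ?thesis
    by (simp add: expand_nonneg_eq fps_divide_unit)
qed

definition delta :: two_sided_series  (\<open>\<delta>\<close>) where
  "\<delta> = (\<lambda>k. 1)"

text \<open>The derivation \<open>x d/dx\<close>.\<close>

definition euler_D :: "two_sided_series \<Rightarrow> two_sided_series" where
  "euler_D f = (\<lambda>k. of_int k * f k)"

text \<open>The series \<open>f(a x)\<close>, for nonzero \<open>a\<close>.\<close>

definition rescale :: "two_sided_series \<Rightarrow> complex \<Rightarrow> two_sided_series" where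
  "rescale f a = (\<lambda>k. f k * a powi k)"

end

theory Submission
  imports Defs
begin

text \<open>
  Both expansions of \<open>1 / (1 - a x)\<close>, namely \<open>expand_nonneg a\<close> and \<open>- expand_neg a\<close>, obey the
  two-pole rule
  \<open>u a * u b = a / (a - b) * u a + b / (b - a) * u b\<close> for \<open>a \<noteq> b\<close>,
  each in its own ring of power series. The rule alone determines the partial fraction
  decomposition of a product with one double and otherwise simple poles
  (\<open>double_pole_partial_fractions\<close>), so both products on the left-hand side decompose with the
  same coefficients; the sign \<open>(-1) ^ n\<close> is exactly what turns \<open>expand_neg\<close> into
  \<open>- expand_neg\<close> in all \<open>n + 2\<close> factors. Hence the difference of the two products is the same
  linear combination of the differences of the two expansions of single terms. For a simple
  pole that difference is \<open>\<delta>(a x)\<close>, and for a double pole it is \<open>(D\<delta>)(a x) + \<delta>(a x)\<close>, because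
  the two expansions of \<open>1 / (1 - a x)\<^sup>2\<close> have the coefficients \<open>(k + 1) a\<^sup>k\<close> for \<open>k \<ge> 0\<close> and
  \<open>- (k + 1) a\<^sup>k\<close> for \<open>k < 0\<close>.
\<close>

section \<open>Partial fractions from the two-pole rule\<close>

definition two_pole_rule :: "'i set \<Rightarrow> ('i \<Rightarrow> 'a::field) \<Rightarrow> ('i \<Rightarrow> 'a fps) \<Rightarrow> bool" where
  "two_pole_rule I A u \<longleftrightarrow> (\<forall>i\<in>I. \<forall>j\<in>I. i \<noteq> j \<longrightarrow>
     u i * u j = fps_const (A i / (A i - A j)) * u i + fps_const (A j / (A j - A i)) * u j)"

lemma two_pole_ruleD:
  assumes "two_pole_rule I A u" "i \<in> I" "j \<in> I" "i \<noteq> j"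
  shows "u i * u j = fps_const (A i / (A i - A j)) * u i + fps_const (A j / (A j - A i)) * u j"
  using assms unfolding two_pole_rule_def by blast

lemma two_pole_rule_subset:
  assumes "two_pole_rule I A u" "J \<subseteq> I"
  shows "two_pole_rule J A u"
  using assms unfolding two_pole_rule_def by blast

text \<open>The value of the remaining factors \<open>1 / (1 - A j x)\<close> at the pole \<open>x = 1 / A i\<close>.\<close>

definition pole_weight :: "('i \<Rightarrow> 'a::field) \<Rightarrow> 'i set \<Rightarrow> 'i \<Rightarrow> 'a" where
  "pole_weight A S i = (\<Prod>j\<in>S - {i}. A i / (A i - A j))"

lemma pole_weight_insert:
  assumes "finite S" "a \<notin> S" "i \<noteq> a"
  shows "pole_weight A (insert a S) i = A i / (A i - A a) * pole_weight A S i"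
proof -
  have "insert a S - {i} = insert a (S - {i})" using assms by auto
  then show ?thesis using assms by (simp add: pole_weight_def)
qed

lemma pole_weight_insert_self:
  assumes "a \<notin> S"
  shows "pole_weight A (insert a S) a = (\<Prod>j\<in>S. A a / (A a - A j))"
  using assms by (simp add: pole_weight_def)

text \<open>The induction removes an index from \<open>T\<close> while the pole \<open>a\<close> outside \<open>T\<close> stays arbitrary:
  splitting \<open>u a * u b\<close> yields two products with one factor fewer, to which the induction
  hypothesis applies with outside poles \<open>a\<close> and \<open>b\<close>. The weights of each \<open>i \<in> T\<close> in the two
  results combine by the two-pole rule itself, with \<open>u\<close> evaluated at \<open>x = 1 / A i\<close>.\<close>

lemma simple_pole_partial_fractions:
  fixes A :: "'i \<Rightarrow> 'a::field"
  assumes "finite T" "a \<notin> T" "inj_on A (insert a T)" "two_pole_rule (insert a T) A u"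
  shows "u a * (\<Prod>i\<in>T. u i)
       = (\<Sum>i\<in>insert a T. fps_const (pole_weight A (insert a T) i) * u i)"
  using assms
proof (induction T arbitrary: a rule: finite_induct)
  case empty
  then show ?case by (simp add: pole_weight_def)
next
  case (insert b T)
  have ab: "a \<noteq> b" and aT: "a \<notin> T" using insert.prems by auto
  define p where "p = A a / (A a - A b)"
  define q where "q = A b / (A b - A a)"
  define W where "W = pole_weight A (insert a (insert b T))"
  have Aab: "A a \<noteq> A b" using insert.prems(2) ab by (auto simp: inj_on_def)
  have IHa: "u a * (\<Prod>i\<in>T. u i)
      = (\<Sum>i\<in>insert a T. fps_const (pole_weight A (insert a T) i) * u i)"
    by (rule insert.IH)
       (use aT insert.prems in \<open>auto intro: inj_on_subset two_pole_rule_subset\<close>)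
  have IHb: "u b * (\<Prod>i\<in>T. u i)
      = (\<Sum>i\<in>insert b T. fps_const (pole_weight A (insert b T) i) * u i)"
    by (rule insert.IH)
       (use insert.hyps insert.prems in \<open>auto intro: inj_on_subset two_pole_rule_subset\<close>)
  have Wa: "W a = p * pole_weight A (insert a T) a"
    unfolding W_def p_def
    using pole_weight_insert[of "insert a T" b a A] insert.hyps ab by (simp add: insert_commute)
  have Wb: "W b = q * pole_weight A (insert b T) b"
    unfolding W_def q_def
    using pole_weight_insert[of "insert b T" a b A] insert.hyps ab aT by simp
  have Wi: "p * pole_weight A (insert a T) i + q * pole_weight A (insert b T) i = W i"
    if "i \<in> T" for i
  proof -
    have ne: "i \<noteq> a" "i \<noteq> b" "A i \<noteq> A a" "A i \<noteq> A b"
      using that aT insert.hyps insert.prems(2) by (auto simp: inj_on_def)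
    \<comment> \<open>the two-pole rule for the numbers \<open>1 / (1 - A a x)\<close> and \<open>1 / (1 - A b x)\<close> at \<open>x = 1 / A i\<close>\<close>
    have "p * (A i / (A i - A a)) + q * (A i / (A i - A b))
        = A i / (A i - A a) * (A i / (A i - A b))"
      using ne Aab unfolding p_def q_def by (simp add: divide_simps) (simp add: algebra_simps)
    then have "p * (A i / (A i - A a)) * pole_weight A T i
        + q * (A i / (A i - A b)) * pole_weight A T i
        = A i / (A i - A a) * (A i / (A i - A b)) * pole_weight A T i"
      by (metis distrib_right)
    then show ?thesis
      unfolding W_def using insert.hyps aT ab ne by (simp add: pole_weight_insert mult.assoc)
  qed
  have "u a * (\<Prod>i\<in>insert b T. u i) = u a * u b * (\<Prod>i\<in>T. u i)"
    using insert.hyps by (simp add: mult.assoc)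
  also have "u a * u b = fps_const p * u a + fps_const q * u b"
    unfolding p_def q_def by (rule two_pole_ruleD[OF insert.prems(3)]) (use ab in auto)
  also have "(fps_const p * u a + fps_const q * u b) * (\<Prod>i\<in>T. u i)
      = fps_const p * (u a * (\<Prod>i\<in>T. u i)) + fps_const q * (u b * (\<Prod>i\<in>T. u i))"
    by (simp only: distrib_right mult.assoc)
  also have "\<dots> = fps_const (W a) * u a + fps_const (W b) * u b
      + (\<Sum>i\<in>T. fps_const (p * pole_weight A (insert a T) i
                          + q * pole_weight A (insert b T) i) * u i)"
    unfolding IHa IHb Wa Wb using insert.hyps aT
    by (simp add: distrib_left distrib_right sum_distrib_left sum.distrib mult.assoc
        flip: fps_const_mult fps_const_add)
  also have "(\<Sum>i\<in>T. fps_const (p * pole_weight A (insert a T) i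
                          + q * pole_weight A (insert b T) i) * u i)
      = (\<Sum>i\<in>T. fps_const (W i) * u i)"
    using Wi by simp
  also have "fps_const (W a) * u a + fps_const (W b) * u b + (\<Sum>i\<in>T. fps_const (W i) * u i)
      = (\<Sum>i\<in>insert a (insert b T). fps_const (W i) * u i)"
    using insert.hyps aT ab by (simp add: add.assoc)
  finally show ?case unfolding W_def .
qed

text \<open>Splitting one factor \<open>u a\<close> of the square against a new factor \<open>u b\<close> leaves a product with
  a double pole but without \<open>b\<close>, which is the induction hypothesis, and one with only simple
  poles. The latter adds \<open>A b / (A b - A a)\<close> to the coefficient of \<open>u a\<close> inside the bracket,
  which is how the sum over \<open>l\<close> builds up.\<close>

lemma double_pole_partial_fractions:
  fixes A :: "'i \<Rightarrow> 'a::field"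
  assumes "finite T" "a \<notin> T" "inj_on A (insert a T)" "two_pole_rule (insert a T) A u"
  shows "(u a)\<^sup>2 * (\<Prod>i\<in>T. u i)
       = (\<Sum>i\<in>T. fps_const ((A i / (A i - A a))\<^sup>2 * pole_weight A T i) * u i)
         + fps_const (\<Prod>i\<in>T. A a / (A a - A i))
           * ((u a)\<^sup>2 + fps_const (\<Sum>l\<in>T. A l / (A l - A a)) * u a)"
  using assms
proof (induction T rule: finite_induct)
  case empty
  then show ?case by simp
next
  case (insert b T)
  have ab: "a \<noteq> b" and aT: "a \<notin> T" using insert.prems by auto
  define p where "p = A a / (A a - A b)"
  define q where "q = A b / (A b - A a)"
  define w where "w = (\<Prod>i\<in>T. A a / (A a - A i))"
  define s where "s = (\<Sum>l\<in>T. A l / (A l - A a))"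
  define C where "C i = (A i / (A i - A a))\<^sup>2 * pole_weight A (insert b T) i" for i
  define D where "D i = (A i / (A i - A a))\<^sup>2 * pole_weight A T i" for i
  define W where "W = pole_weight A (insert a (insert b T))"
  have Aab: "A a \<noteq> A b" using insert.prems(2) ab by (auto simp: inj_on_def)
  have IH: "(u a)\<^sup>2 * (\<Prod>i\<in>T. u i)
      = (\<Sum>i\<in>T. fps_const (D i) * u i)
        + fps_const w * ((u a)\<^sup>2 + fps_const s * u a)"
    unfolding w_def s_def D_def
    by (rule insert.IH) (use aT insert.prems in \<open>auto intro: inj_on_subset two_pole_rule_subset\<close>)
  have simple: "u a * (\<Prod>i\<in>insert b T. u i)
      = fps_const (W a) * u a + fps_const (W b) * u b + (\<Sum>i\<in>T. fps_const (W i) * u i)"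
    unfolding W_def
    using simple_pole_partial_fractions[OF _ insert.prems] insert.hyps insert.prems(1)
    by (simp add: add.assoc)
  have Wa: "W a = p * w"
    unfolding W_def p_def w_def using insert.hyps insert.prems(1)
    by (subst pole_weight_insert_self) auto
  have Cb: "q * W b = C b"
    unfolding W_def C_def q_def using insert.hyps insert.prems(1) ab
    by (subst pole_weight_insert) (auto simp: power2_eq_square)
  have Ci: "p * D i + q * W i = C i" if "i \<in> T" for i
  proof -
    have ne: "i \<noteq> a" "i \<noteq> b" "A i \<noteq> A a" "A i \<noteq> A b"
      using that aT insert.hyps insert.prems(2) by (auto simp: inj_on_def)
    \<comment> \<open>again the two-pole rule at \<open>x = 1 / A i\<close>, times the value of the other factor \<open>u a\<close>\<close>
    have "p * (A i / (A i - A a))\<^sup>2 + q * (A i / (A i - A a) * (A i / (A i - A b)))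
        = (A i / (A i - A a))\<^sup>2 * (A i / (A i - A b))"
      using ne Aab unfolding p_def q_def power2_eq_square
      by (simp add: divide_simps) (simp add: algebra_simps)
    then have "p * (A i / (A i - A a))\<^sup>2 * pole_weight A T i
        + q * (A i / (A i - A a) * (A i / (A i - A b))) * pole_weight A T i
        = (A i / (A i - A a))\<^sup>2 * (A i / (A i - A b)) * pole_weight A T i"
      by (metis distrib_right)
    then show ?thesis
      unfolding W_def C_def D_def using insert.hyps aT ab ne
      by (simp add: pole_weight_insert mult.assoc)
  qed
  have "(u a)\<^sup>2 * (\<Prod>i\<in>insert b T. u i) = u a * u b * (u a * (\<Prod>i\<in>T. u i))"
    using insert.hyps by (simp add: power2_eq_square mult_ac)
  also have "u a * u b = fps_const p * u a + fps_const q * u b"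
    unfolding p_def q_def by (rule two_pole_ruleD[OF insert.prems(3)]) (use ab in auto)
  also have "(fps_const p * u a + fps_const q * u b) * (u a * (\<Prod>i\<in>T. u i))
      = fps_const p * ((u a)\<^sup>2 * (\<Prod>i\<in>T. u i)) + fps_const q * (u a * (\<Prod>i\<in>insert b T. u i))"
    using insert.hyps by (simp add: power2_eq_square algebra_simps)
  also have "\<dots> = (\<Sum>i\<in>T. fps_const (p * D i + q * W i) * u i) + fps_const (q * W b) * u b
      + fps_const (p * w) * ((u a)\<^sup>2 + fps_const (q + s) * u a)"
    unfolding IH simple Wa
    by (simp add: algebra_simps sum_distrib_left sum.distrib
        flip: fps_const_mult fps_const_add)
  also have "\<dots> = (\<Sum>i\<in>insert b T. fps_const (C i) * u i)
      + fps_const (p * w) * ((u a)\<^sup>2 + fps_const (q + s) * u a)"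
    using insert.hyps Ci Cb by (simp add: add.commute)
  finally show ?case
    using insert.hyps unfolding C_def p_def q_def w_def s_def by simp
qed

section \<open>The two expansions of a pole\<close>

text \<open>The pole is \<open>s / (s - a t)\<close>: with \<open>s = 1\<close> and \<open>t = x\<close> this is the expansion in powers of
  \<open>x\<close>, with \<open>s = x\<^sup>-\<^sup>1\<close> and \<open>t = 1\<close> the one in powers of \<open>x\<^sup>-\<^sup>1\<close>. The rule follows by
  clearing the two denominators, which are not zero divisors.\<close>

lemma two_pole_rule_homogeneous:
  fixes A :: "'i \<Rightarrow> 'a::field"
  assumes s: "s \<noteq> 0" and inj: "inj_on A I"
    and u: "\<And>i. i \<in> I \<Longrightarrow> u i * (s - fps_const (A i) * t) = s"
  shows "two_pole_rule I A u"
  unfolding two_pole_rule_def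
proof (intro ballI impI)
  fix i j assume ij: "i \<in> I" "j \<in> I" "i \<noteq> j"
  define p where "p = A i / (A i - A j)"
  define q where "q = A j / (A j - A i)"
  define di where "di = s - fps_const (A i) * t"
  define dj where "dj = s - fps_const (A j) * t"
  have A: "A i \<noteq> A j" using inj ij by (auto simp: inj_on_def)
  have ui: "u i * di = s" and uj: "u j * dj = s"
    using u ij unfolding di_def dj_def by auto
  have "di \<noteq> 0" "dj \<noteq> 0" using ui uj s by auto
  have pq: "p + q = 1" "p * A j + q * A i = 0"
    using A unfolding p_def q_def by (simp_all add: divide_simps) (simp_all add: algebra_simps)
  have "fps_const p * dj + fps_const q * di
      = fps_const (p + q) * s - fps_const (p * A j + q * A i) * t"
    unfolding di_def dj_def by (simp add: algebra_simps flip: fps_const_mult fps_const_add)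
  then have combine: "fps_const p * dj + fps_const q * di = s"
    by (simp add: pq)
  have "(u i * u j) * (di * dj) = s * s"
    using ui uj by (metis mult.assoc mult.left_commute)
  also have "\<dots> = fps_const p * (u i * di) * dj + fps_const q * (u j * dj) * di"
    unfolding ui uj using combine by (metis distrib_left mult.commute mult.left_commute)
  also have "\<dots> = (fps_const p * u i + fps_const q * u j) * (di * dj)"
    by (simp add: algebra_simps)
  finally have "u i * u j = fps_const p * u i + fps_const q * u j"
    using \<open>di \<noteq> 0\<close> \<open>dj \<noteq> 0\<close> by simp
  then show "u i * u j
      = fps_const (A i / (A i - A j)) * u i + fps_const (A j / (A j - A i)) * u j"
    unfolding p_def q_def .
qed

lemma two_pole_rule_expand_nonneg:
  assumes "inj_on A I"
  shows "two_pole_rule I A (\<lambda>i. expand_nonneg (A i))"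
proof (rule two_pole_rule_homogeneous[where s = 1 and t = fps_X])
  fix i
  show "expand_nonneg (A i) * (1 - fps_const (A i) * fps_X) = 1"
    unfolding expand_nonneg_eq by (simp add: fps_divide_unit inverse_mult_eq_1)
qed (use assms in auto)

lemma expand_neg_alt: "expand_neg a = expand_nonneg (inverse a) - 1"
  by (rule fps_ext) (simp add: expand_neg_def expand_nonneg_def)

lemma two_pole_rule_expand_neg:
  assumes "inj_on A I" "\<And>i. i \<in> I \<Longrightarrow> A i \<noteq> 0"
  shows "two_pole_rule I A (\<lambda>i. - expand_neg (A i))"
proof (rule two_pole_rule_homogeneous[where s = fps_X and t = 1])
  fix i assume "i \<in> I"
  define a where "a = A i"
  have a: "a \<noteq> 0" using assms(2) \<open>i \<in> I\<close> unfolding a_def by blast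
  have inv: "expand_nonneg (inverse a) * (1 - fps_const (inverse a) * fps_X) = 1"
    unfolding expand_nonneg_eq by (simp add: fps_divide_unit inverse_mult_eq_1)
  have "fps_const a * (1 - fps_const (inverse a) * fps_X) = fps_const a - fps_X"
    using a by (simp add: right_diff_distrib flip: mult.assoc)
  then have "expand_nonneg (inverse a) * (fps_const a - fps_X) = fps_const a"
    using inv by (metis mult.left_commute mult.right_neutral)
  then have "- expand_neg a * (fps_X - fps_const a) = fps_X"
    unfolding expand_neg_alt by (simp add: algebra_simps)
  then show "- expand_neg (A i) * (fps_X - fps_const (A i) * 1) = fps_X"
    unfolding a_def by simp
qed (use assms in auto)

text \<open>The two-sided series that a rational function leaves when its expansion in powers of
  \<open>x\<^sup>-\<^sup>1\<close> is subtracted from that in powers of \<open>x\<close>. It takes the two expansions rather than the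
  rational function, so that it is linear in the pair.\<close>

definition expansion_difference :: "complex fps \<Rightarrow> complex fps \<Rightarrow> two_sided_series" where
  "expansion_difference f g = (\<lambda>k. at_x f k - at_x_inverse g k)"

lemma expansion_difference_add:
  "expansion_difference (f + f') (g + g') k
     = expansion_difference f g k + expansion_difference f' g' k"
  by (simp add: expansion_difference_def at_x_def at_x_inverse_def)

lemma expansion_difference_const_mult:
  "expansion_difference (fps_const c * f) (fps_const c * g) k = c * expansion_difference f g k"
  by (simp add: expansion_difference_def at_x_def at_x_inverse_def right_diff_distrib)

lemma expansion_difference_sum:
  "expansion_difference (\<Sum>i\<in>S. f i) (\<Sum>i\<in>S. g i) k
     = (\<Sum>i\<in>S. expansion_difference (f i) (g i) k)"
  by (simp add: expansion_difference_def at_x_def at_x_inverse_def fps_sum_nth sum_subtractf)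

lemma expansion_difference_simple_pole:
  "expansion_difference (expand_nonneg a) (- expand_neg a) k = rescale \<delta> a k"
  by (auto simp: expansion_difference_def at_x_def at_x_inverse_def expand_nonneg_def
      expand_neg_def rescale_def delta_def power_int_def)

lemma fps_nth_expand_nonneg_square: "fps_nth ((expand_nonneg a)\<^sup>2) m = of_nat (m + 1) * a ^ m"
proof -
  have "fps_nth ((expand_nonneg a)\<^sup>2) m = (\<Sum>i=0..m. a ^ i * a ^ (m - i))"
    by (simp add: power2_eq_square fps_mult_nth expand_nonneg_def)
  also have "\<dots> = (\<Sum>i=0..m. a ^ m)"
    by (rule sum.cong) (simp_all flip: power_add)
  finally show ?thesis by simp
qed

lemma fps_nth_expand_neg_square:
  "fps_nth ((expand_neg a)\<^sup>2) m = (if m = 0 then 0 else (of_nat m - 1) * inverse a ^ m)"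
proof -
  have "(expand_neg a)\<^sup>2 = (expand_nonneg (inverse a))\<^sup>2 - fps_const 2 * expand_nonneg (inverse a) + 1"
    unfolding expand_neg_alt by (simp add: power2_diff flip: numeral_fps_const)
  then show ?thesis
    by (simp add: fps_nth_expand_nonneg_square) (simp add: expand_nonneg_def algebra_simps)
qed

text \<open>The coefficient at \<open>k = -1\<close> is zero on both sides: the square of \<open>expand_neg a\<close> starts at
  \<open>x\<^sup>-\<^sup>2\<close>, and \<open>(k + 1) a\<^sup>k\<close> vanishes there, so no gap is left between the two halves.\<close>

lemma expansion_difference_double_pole:
  "expansion_difference ((expand_nonneg a)\<^sup>2) ((expand_neg a)\<^sup>2) k
     = rescale (euler_D \<delta>) a k + rescale \<delta> a k"
  by (auto simp: expansion_difference_def at_x_def at_x_inverse_def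
      fps_nth_expand_nonneg_square fps_nth_expand_neg_square
      rescale_def delta_def euler_D_def power_int_def algebra_simps)

section \<open>The identity of two-sided series\<close>

theorem proposition2p7:
  fixes n :: nat and A :: "nat \<Rightarrow> complex"
  assumes "n \<ge> 1"
    and "inj_on A {0..n}"
    and "\<forall>i\<in>{0..n}. A i \<noteq> 0"
  shows
    "(\<lambda>k. at_x ((expand_nonneg (A 0))\<^sup>2 * (\<Prod>i=1..n. expand_nonneg (A i))) k
        - (-1) ^ n * at_x_inverse ((expand_neg (A 0))\<^sup>2 * (\<Prod>i=1..n. expand_neg (A i))) k)
     = (\<lambda>k. (\<Sum>i=1..n. ((A i / (A i - A 0))\<^sup>2 * (\<Prod>j\<in>{1..n} - {i}. A i / (A i - A j)))
                 * rescale \<delta> (A i) k)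
        + (\<Prod>i=1..n. A 0 / (A 0 - A i))
          * (rescale (euler_D \<delta>) (A 0) k
             + (1 + (\<Sum>l=1..n. A l / (A l - A 0))) * rescale \<delta> (A 0) k))"
proof
  fix k
  define w where "w = (\<Prod>i=1..n. A 0 / (A 0 - A i))"
  define s where "s = (\<Sum>l=1..n. A l / (A l - A 0))"
  define c where "c i = (A i / (A i - A 0))\<^sup>2 * pole_weight A {1..n} i" for i
  have ins: "insert 0 {1..n} = {0..n}" by auto
  have inj: "inj_on A (insert 0 {1..n})" and nz: "\<And>i. i \<in> insert 0 {1..n} \<Longrightarrow> A i \<noteq> 0"
    using assms unfolding ins by auto
  have decomposition: "(u 0)\<^sup>2 * (\<Prod>i=1..n. u i) = (\<Sum>i=1..n. fps_const (c i) * u i)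
      + fps_const w * ((u 0)\<^sup>2 + fps_const s * u 0)"
    if "two_pole_rule (insert 0 {1..n}) A u" for u
    unfolding c_def w_def s_def
    by (rule double_pole_partial_fractions) (use inj that in auto)
  define F where "F = (expand_nonneg (A 0))\<^sup>2 * (\<Prod>i=1..n. expand_nonneg (A i))"
  define G where "G = (expand_neg (A 0))\<^sup>2 * (\<Prod>i=1..n. expand_neg (A i))"
  have F: "F = (\<Sum>i=1..n. fps_const (c i) * expand_nonneg (A i))
      + fps_const w * ((expand_nonneg (A 0))\<^sup>2 + fps_const s * expand_nonneg (A 0))"
    unfolding F_def by (rule decomposition[OF two_pole_rule_expand_nonneg[OF inj]])
  have "(\<Prod>i=1..n. - expand_neg (A i)) = (-1) ^ n * (\<Prod>i=1..n. expand_neg (A i))"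
    using prod.distrib[of "\<lambda>_. -1" "\<lambda>i. expand_neg (A i)" "{1..n}"] by simp
  then have "fps_const ((-1) ^ n) * G = (- expand_neg (A 0))\<^sup>2 * (\<Prod>i=1..n. - expand_neg (A i))"
    unfolding G_def by (simp add: mult.left_commute flip: fps_const_power fps_const_neg)
  also have "\<dots> = (\<Sum>i=1..n. fps_const (c i) * (- expand_neg (A i)))
      + fps_const w * ((- expand_neg (A 0))\<^sup>2 + fps_const s * (- expand_neg (A 0)))"
    by (rule decomposition[OF two_pole_rule_expand_neg[OF inj nz]])
  also have "(- expand_neg (A 0))\<^sup>2 = (expand_neg (A 0))\<^sup>2"
    by simp
  finally have G: "fps_const ((-1) ^ n) * G = (\<Sum>i=1..n. fps_const (c i) * (- expand_neg (A i)))
      + fps_const w * ((expand_neg (A 0))\<^sup>2 + fps_const s * (- expand_neg (A 0)))" .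
  have "at_x F k - (-1) ^ n * at_x_inverse G k = expansion_difference F (fps_const ((-1) ^ n) * G) k"
    by (simp add: expansion_difference_def at_x_inverse_def)
  also have "\<dots> = (\<Sum>i=1..n. c i * rescale \<delta> (A i) k)
      + w * (rescale (euler_D \<delta>) (A 0) k + (1 + s) * rescale \<delta> (A 0) k)"
    unfolding F G
    by (simp only: expansion_difference_add expansion_difference_const_mult
        expansion_difference_sum expansion_difference_simple_pole
        expansion_difference_double_pole distrib_right mult_1_left add.assoc)
  finally show "at_x ((expand_nonneg (A 0))\<^sup>2 * (\<Prod>i=1..n. expand_nonneg (A i))) k
        - (-1) ^ n * at_x_inverse ((expand_neg (A 0))\<^sup>2 * (\<Prod>i=1..n. expand_neg (A i))) k
     = (\<Sum>i=1..n. ((A i / (A i - A 0))\<^sup>2 * (\<Prod>j\<in>{1..n} - {i}. A i / (A i - A j)))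
                 * rescale \<delta> (A i) k)
        + (\<Prod>i=1..n. A 0 / (A 0 - A i))
          * (rescale (euler_D \<delta>) (A 0) k
             + (1 + (\<Sum>l=1..n. A l / (A l - A 0))) * rescale \<delta> (A 0) k)"
    unfolding F_def G_def c_def w_def s_def pole_weight_def .
qed

end
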